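(* Let $G\in\mathbb{G}$, $\zeta>0$, and let $\pi$ be any initial distribution on $\Sigma$. Then, under $\mathbb{P}^{G,\zeta}_\pi$, $$X_n \ \stackrel{d}{\longrightarrow}\ \nu_{G,\pi,\zeta}\qquad (n\to\infty),$$ where $\nu_{G,\pi,\zeta}$ is a probability vector on $\Sigma$ depending in general on $\zeta$, $G$ and $\pi$. When $0<\zeta\le 1$, $\nu_{G,\pi,\zeta}$ does not depend on $\pi$ and $\zeta$ and reduces to $\nu_{G,\pi,\zeta}=\nu_G$.
   Context: Let $\Sigma=\{1,\ldots,m\}$ with $m\ge 2$. $\mathbb{G}$ is the set of real $m\times m$ matrices $G$ with $G(i,j)>0$ for all distinct $i,j$ and $G(i,i)=-\sum_{j\ne i}G(i,j)$ (so $G(i,i)<0$). For $G\in\mathbb{G}$ and $\zeta>0$ put $n(G,\zeta)=\lceil \max_{1\le i\le m}|G(i,i)|^{1/\zeta}\rceil$ and define stochastic matrices $P^{G,\zeta}_n=I$ for $1\le n\le n(G,\zeta)$ and $P^{G,\zeta}_n=I+G/n^\zeta$ for $n\ge n(G,\zeta)+1$, where $I$ is the $m\times m$ identity. For a distribution $\pi$ on $\Sigma$, $\mathbb{P}^{G,\zeta}_\pi$ is the law on $\Sigma^{\{0,1,2,\ldots\}}$ of the time-nonhomogeneous Markov chain $(X_n)_{n\ge 0}$ (coordinate process) with $\mathbb{P}^{G,\zeta}_\pi(X_0=i)=\pi(i)$ and $\mathbb{P}^{G,\zeta}_\pi(X_{n+1}=j\mid X_0,\ldots,X_{n-1},X_n=i)=P^{G,\zeta}_{n+1}(i,j)$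 for $n\ge 0$. $\nu_G$ is the stationary distribution of $G$: the unique left eigenvector of $G$ for the eigenvalue $0$ with positive entries summing to $1$. $\stackrel{d}{\longrightarrow}$ denotes convergence in distribution. *)

theory Defs
  imports "HOL-Probability.Probability"
begin

text \<open>The state space \<open>{1, \<dots>, m}\<close> is the finite type \<^typ>\<open>'m\<close>, with \<open>m = CARD('m)\<close>;
  row and column vectors are both of type \<^typ>\<open>real^'m\<close>.\<close>

definition generators :: "(real^'m^'m) set" where
  "generators = {G. (\<forall>i j. i \<noteq> j \<longrightarrow> 0 < G $ i $ j) \<and>
                    (\<forall>i. G $ i $ i = - (\<Sum>j \<in> UNIV - {i}. G $ i $ j))}"

definition prob_vectors :: "(real^'m) set" where
  "prob_vectors = {p. (\<forall>i. 0 \<le> p $ i) \<and> (\<Sum>i\<in>UNIV. p $ i) = 1}"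

definition threshold :: "real^'m^'m \<Rightarrow> real \<Rightarrow> nat" where
  "threshold G \<zeta> = nat \<lceil>MAX i. \<bar>G $ i $ i\<bar> powr (1 / \<zeta>)\<rceil>"

text \<open>Only \<open>n \<ge> 1\<close> matters.\<close>

definition trans_mat :: "real^'m^'m \<Rightarrow> real \<Rightarrow> nat \<Rightarrow> real^'m^'m" where
  "trans_mat G \<zeta> n =
     (if n \<le> threshold G \<zeta> then mat 1 else mat 1 + (1 / real n powr \<zeta>) *\<^sub>R G)"

abbreviation path_space :: "(nat \<Rightarrow> 'm) measure" where
  "path_space \<equiv> (\<Pi>\<^sub>M n\<in>UNIV. count_space UNIV)"

text \<open>\<open>M\<close> is the law of the chain on path space. The conditioning events are the elementary ones
  \<open>X\<^sub>0 = x\<^sub>0, \<dots>, X\<^sub>n = x\<^sub>n\<close>, restricted to those of positive probability. Existence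
  is \<open>ex_chain_law\<close> below; uniqueness holds because the prescribed values determine the
  probabilities of all cylinder sets.\<close>

definition is_chain_law ::
    "real^'m^'m \<Rightarrow> real \<Rightarrow> real^'m \<Rightarrow> (nat \<Rightarrow> 'm) measure \<Rightarrow> bool" where
  "is_chain_law G \<zeta> \<pi> M \<longleftrightarrow>
     prob_space M \<and> sets M = sets path_space \<and>
     (\<forall>i. \<P>(\<omega> in M. \<omega> 0 = i) = \<pi> $ i) \<and>
     (\<forall>n x j. 0 < \<P>(\<omega> in M. \<forall>k\<le>n. \<omega> k = x k) \<longrightarrow>
        \<P>(\<omega> in M. \<omega> (Suc n) = j \<bar> \<forall>k\<le>n. \<omega> k = x k) = trans_mat G \<zeta> (Suc n) $ x n $ j)"

text \<open>A left eigenvector for the eigenvalue \<open>0\<close> is a nonzero \<open>v\<close> with \<open>v G = 0\<close>;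
  \<open>v \<noteq> 0\<close> is implied by the positivity of the entries.\<close>

definition stationary :: "real^'m^'m \<Rightarrow> real^'m" where
  "stationary G = (THE v. v v* G = 0 \<and> (\<forall>i. 0 < v $ i) \<and> (\<Sum>i\<in>UNIV. v $ i) = 1)"

text \<open>Weak convergence of probability measures on a topological space. The library's
  \<^const>\<open>weak_conv_m\<close> covers the real line only.\<close>

definition weak_conv_on :: "'a topology \<Rightarrow> (nat \<Rightarrow> 'a measure) \<Rightarrow> 'a measure \<Rightarrow> bool" where
  "weak_conv_on T \<mu> \<nu> \<longleftrightarrow>
     (\<forall>f :: 'a \<Rightarrow> real. continuous_map T euclidean f \<and> bounded (f ` topspace T) \<longrightarrow>
        (\<lambda>n. \<integral>x. f x \<partial>\<mu> n) \<longlonglongrightarrow> (\<integral>x. f x \<partial>\<nu>))"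

definition law_of_vec :: "real^'m \<Rightarrow> 'm measure" where
  "law_of_vec p = point_measure UNIV (\<lambda>i. ennreal (p $ i))"

definition coord_conv_in_distr :: "(nat \<Rightarrow> 'm) measure \<Rightarrow> real^'m \<Rightarrow> bool" where
  "coord_conv_in_distr M p \<longleftrightarrow>
     weak_conv_on (discrete_topology UNIV)
       (\<lambda>n. distr M (count_space UNIV) (\<lambda>\<omega>. \<omega> n)) (law_of_vec p)"


lemma trans_mat_stochastic:
  fixes G :: "real^'m^'m"
  assumes G: "G \<in> generators" and z: "\<zeta> > 0"
  shows "trans_mat G \<zeta> n $ i \<in> prob_vectors"
proof -
  have off: "i \<noteq> j \<Longrightarrow> 0 < G $ i $ j" for j
    using G by (auto simp: generators_def)
  have diag: "G $ i $ i = - (\<Sum>j \<in> UNIV - {i}. G $ i $ j)"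
    using G by (auto simp: generators_def)
  have sum0: "(\<Sum>j\<in>UNIV. G $ i $ j) = 0"
    using sum.remove[of UNIV i "\<lambda>j. G $ i $ j"] diag by simp
  have s1: "(\<Sum>j\<in>UNIV. (mat 1 :: real^'m^'m) $ i $ j) = 1"
    by (simp add: mat_def)
  show ?thesis
  proof (cases "n \<le> threshold G \<zeta>")
    case True
    then show ?thesis using s1
      by (auto simp: trans_mat_def prob_vectors_def mat_def)
  next
    case False
    define a where "a = \<bar>G $ i $ i\<bar> powr (1 / \<zeta>)"
    have "a \<le> (MAX i. \<bar>G $ i $ i\<bar> powr (1 / \<zeta>))"
      unfolding a_def by (intro Max_ge) auto
    then have an: "a \<le> real n"
      using False unfolding threshold_def by linarith
    have n0: "n > 0" using False by simp
    have "\<bar>G $ i $ i\<bar> = a powr \<zeta>"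
      using z by (simp add: a_def powr_powr)
    also have "\<dots> \<le> real n powr \<zeta>"
      using an z by (intro powr_mono2) (auto simp: a_def)
    finally have le: "- G $ i $ i \<le> real n powr \<zeta>" by linarith
    have pos: "0 < real n powr \<zeta>" using n0 by simp
    have "0 \<le> trans_mat G \<zeta> n $ i $ j" for j
    proof (cases "i = j")
      case True
      then show ?thesis using False le pos
        by (simp add: trans_mat_def mat_def field_simps)
    next
      case neq: False
      then show ?thesis using False off[OF neq] pos
        by (simp add: trans_mat_def mat_def)
    qed
    moreover have "(\<Sum>j\<in>UNIV. trans_mat G \<zeta> n $ i $ j) = 1"
      using False s1 sum0
      by (simp add: trans_mat_def sum.distrib flip: sum_divide_distrib)
    ultimately show ?thesis by (auto simp: prob_vectors_def)
  qed
qed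

lemma prob_space_law_of_vec:
  "p \<in> prob_vectors \<Longrightarrow> prob_space (law_of_vec p)"
  unfolding law_of_vec_def prob_vectors_def
  by (intro prob_spaceI) (simp add: space_point_measure emeasure_point_measure_finite sum_ennreal)

lemma ex_chain_law:
  fixes G :: "real^'m^'m"
  assumes G: "G \<in> generators" and z: "\<zeta> > 0" and p: "\<pi> \<in> prob_vectors"
  shows "\<exists>M. is_chain_law G \<zeta> \<pi> M"
proof -
  define row where "row n \<omega> = (case n of 0 \<Rightarrow> \<pi> | Suc k \<Rightarrow> trans_mat G \<zeta> n $ \<omega> k)"
    for n and \<omega> :: "nat \<Rightarrow> 'm"
  define K where "K n \<omega> = law_of_vec (row n \<omega>)" for n \<omega>
  define S where "S = (\<lambda>_::nat. count_space (UNIV::'m set))"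
  have row: "row n \<omega> \<in> prob_vectors" for n \<omega>
    using trans_mat_stochastic[OF G z] p by (auto simp: row_def split: nat.split)
  have pK: "prob_space (K n \<omega>)" for n \<omega>
    unfolding K_def using row by (rule prob_space_law_of_vec)
  have setsK: "sets (K n \<omega>) = sets (count_space UNIV)" for n \<omega>
    by (simp add: K_def law_of_vec_def sets_point_measure)
  have inK: "K n \<omega> \<in> space (subprob_algebra (count_space UNIV))" for n \<omega>
    using pK setsK by (simp add: space_subprob_algebra prob_space_imp_subprob_space)
  have mK: "K n \<in> measurable (PiM {0..<n} S) (subprob_algebra (S n))" for n
  proof (cases n)
    case 0
    then have "K n = (\<lambda>_. K 0 undefined)" by (auto simp: K_def row_def fun_eq_iff)
    then show ?thesis using inK by (simp add: S_def)
  next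
    case (Suc k)
    have "(\<lambda>i. K n (\<lambda>_. i)) \<in> measurable (S k) (subprob_algebra (S n))"
      using inK by (simp add: S_def)
    moreover have "(\<lambda>\<omega>. \<omega> k) \<in> measurable (PiM {0..<n} S) (S k)"
      using Suc by (intro measurable_component_singleton) auto
    ultimately have "(\<lambda>\<omega>. K n (\<lambda>_. \<omega> k)) \<in> measurable (PiM {0..<n} S) (subprob_algebra (S n))"
      by measurable
    then show ?thesis using Suc by (simp add: K_def row_def cong: measurable_cong)
  qed
  interpret IT: Ionescu_Tulcea K S
    by (rule Ionescu_Tulcea.intro[OF mK pK])
  define M where "M = IT.PF.lim"
  have setsM: "sets M = sets path_space"
    using IT.PF.sets_lim unfolding M_def S_def by simp
  have spaceM: "space M = UNIV"
    using sets_eq_imp_space_eq[OF setsM] by (simp add: space_PiM)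
  have eK: "emeasure (K n \<omega>) {j} = ennreal (row n \<omega> $ j)" for n \<omega> j
    by (simp add: K_def law_of_vec_def emeasure_point_measure_finite)
  have single: "{restrict x {0..<n}} \<in> sets (PiM {0..<n} S)" for x n
  proof -
    have "{restrict x {0..<n}} = PiE {0..<n} (\<lambda>i. {x i})"
      by (auto simp: PiE_iff extensional_def fun_eq_iff)
    then show ?thesis by (auto simp: S_def intro!: sets_PiM_I_finite)
  qed
  have step: "IT.C 0 (Suc n) (\<lambda>_. undefined) {restrict x {0..<Suc n}} =
      IT.C 0 n (\<lambda>_. undefined) {restrict x {0..<n}} * ennreal (row n x $ x n)" for n x
  proof -
    let ?C = "IT.C 0 n (\<lambda>_. undefined)"
    have u: "(\<lambda>_. undefined) \<in> space (PiM {0..<0} S)" by (simp add: space_PiM)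
    have spC: "space ?C = space (PiM {0..<n} S)" using IT.space_C[OF u, of n] by simp
    have seC: "sets ?C = sets (PiM {0..<n} S)" using IT.sets_C[OF u, of n] by simp
    have meP: "IT.eP n \<in> measurable ?C (subprob_algebra (PiM {0..<Suc n} S))"
      using IT.measurable_eP[of n] by (simp add: measurable_cong_sets[OF seC refl])
    have ne: "space ?C \<noteq> {}" unfolding spC by (auto simp: space_PiM S_def PiE_eq_empty_iff)
    have key: "IT.eP n \<omega> {restrict x {0..<Suc n}} =
        ennreal (row n x $ x n) * indicator {restrict x {0..<n}} \<omega>"
      if w: "\<omega> \<in> space ?C" for \<omega>
    proof -
      have w': "\<omega> \<in> space (PiM {0..<n} S)" using w spC by simp
      have ext: "\<omega> \<in> extensional {0..<n}" using w' by (simp add: space_PiM PiE_iff)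
      have vi: "(\<lambda>y. fun_upd \<omega> n y) -` {restrict x {0..<Suc n}} \<inter> space (S n) =
          (if \<omega> = restrict x {0..<n} then {x n} else {})"
      proof -
        have "fun_upd \<omega> n y = restrict x {0..<Suc n} \<longleftrightarrow> \<omega> = restrict x {0..<n} \<and> y = x n" for y
        proof
          assume eq: "fun_upd \<omega> n y = restrict x {0..<Suc n}"
          have "y = x n" using fun_cong[OF eq, of n] by simp
          moreover have "\<omega> k = restrict x {0..<n} k" for k
            using fun_cong[OF eq, of k] extensional_arb[OF ext, of k]
            by (cases "k < n") (auto split: if_splits)
          ultimately show "\<omega> = restrict x {0..<n} \<and> y = x n" by auto
        next
          assume "\<omega> = restrict x {0..<n} \<and> y = x n"
          then show "fun_upd \<omega> n y = restrict x {0..<Suc n}"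
            by (auto simp: fun_eq_iff restrict_def)
        qed
        then show ?thesis by (auto simp: S_def)
      qed
      have rr: "row n (restrict x {0..<n}) = row n x" by (simp add: row_def split: nat.split)
      show ?thesis
        unfolding IT.emeasure_eP[OF w' single] vi
        by (auto simp: eK rr)
    qed
    have "IT.C 0 (Suc n) (\<lambda>_. undefined) {restrict x {0..<Suc n}} =
        (\<integral>\<^sup>+\<omega>. IT.eP n \<omega> {restrict x {0..<Suc n}} \<partial>?C)"
      using emeasure_bind[OF ne meP single] by simp
    also have "\<dots> = (\<integral>\<^sup>+\<omega>. ennreal (row n x $ x n) * indicator {restrict x {0..<n}} \<omega> \<partial>?C)"
      by (intro nn_integral_cong key)
    also have "\<dots> = ennreal (row n x $ x n) * ?C {restrict x {0..<n}}"
      using single seC by (intro nn_integral_cmult_indicator) simp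
    finally show ?thesis by (simp add: mult.commute)
  qed
  have cyl: "emeasure M {\<omega>. \<forall>k<n. \<omega> k = x k} = IT.C 0 n (\<lambda>_. undefined) {restrict x {0..<n}}" for n x
  proof -
    have "{\<omega>. \<forall>k<n. \<omega> k = x k} = IT.PF.emb UNIV {0..<n} {restrict x {0..<n}}"
    proof -
      have "restrict \<omega> {0..<n} = restrict x {0..<n} \<longleftrightarrow> (\<forall>k<n. \<omega> k = x k)" for \<omega>
        by (auto simp: fun_eq_iff restrict_def)
      then show ?thesis by (auto simp: prod_emb_def S_def)
    qed
    then have "emeasure M {\<omega>. \<forall>k<n. \<omega> k = x k} = IT.CI {0..<n} {restrict x {0..<n}}"
      unfolding M_def using IT.lim[OF _ single, of n x] by simp
    also have "\<dots> = IT.C 0 n (\<lambda>_. undefined) (IT.PF.emb {0..<n} {0..<n} {restrict x {0..<n}})"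
      by (intro IT.emeasure_CI single) simp
    also have "IT.PF.emb {0..<n} {0..<n} {restrict x {0..<n}} = {restrict x {0..<n}}"
      using single by (intro prod_emb_id) (auto dest: sets.sets_into_space simp: space_PiM S_def)
    finally show ?thesis .
  qed
  have e0: "emeasure M UNIV = 1"
    using cyl[of 0 undefined] single[of undefined 0] by (simp add: restrict_def)
  interpret PM: prob_space M
    by (rule prob_spaceI) (simp add: spaceM e0)
  have rn: "0 \<le> row n \<omega> $ j" for n \<omega> j using row by (simp add: prob_vectors_def)
  have mstep: "measure M {\<omega>. \<forall>k<Suc n. \<omega> k = x k} =
      measure M {\<omega>. \<forall>k<n. \<omega> k = x k} * row n x $ x n" for n x
    unfolding measure_def cyl step by (simp add: enn2real_mult rn)
  have "measure M {\<omega>. \<omega> 0 = i} = \<pi> $ i" for i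
    using mstep[of 0 "\<lambda>_. i"] PM.prob_space by (simp add: spaceM row_def)
  moreover have "\<P>(\<omega> in M. \<omega> (Suc n) = j \<bar> \<forall>k\<le>n. \<omega> k = x k) = trans_mat G \<zeta> (Suc n) $ x n $ j"
    if pos: "0 < \<P>(\<omega> in M. \<forall>k\<le>n. \<omega> k = x k)" for n x j
  proof -
    let ?x = "x(Suc n := j)"
    have "{\<omega>. \<omega> (Suc n) = j \<and> (\<forall>k\<le>n. \<omega> k = x k)} = {\<omega>. \<forall>k<Suc (Suc n). \<omega> k = ?x k}"
      by (auto simp: less_Suc_eq_le le_Suc_eq)
    moreover have "{\<omega>. \<forall>k<Suc n. \<omega> k = ?x k} = {\<omega>. \<forall>k\<le>n. \<omega> k = x k}"
      by (auto simp: less_Suc_eq_le)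
    ultimately have "measure M {\<omega>. \<omega> (Suc n) = j \<and> (\<forall>k\<le>n. \<omega> k = x k)} =
        measure M {\<omega>. \<forall>k\<le>n. \<omega> k = x k} * trans_mat G \<zeta> (Suc n) $ x n $ j"
      using mstep[of "Suc n" ?x] by (simp add: row_def)
    then show ?thesis using pos by (simp add: cond_prob_def spaceM)
  qed
  ultimately have "is_chain_law G \<zeta> \<pi> M"
    unfolding is_chain_law_def using setsM PM.prob_space_axioms by (simp add: spaceM)
  then show ?thesis ..
qed

end

theory Submission
  imports Defs "HOL-Real_Asymp.Real_Asymp"
begin

text \<open>The law of \<open>X\<^sub>n\<close> is \<open>\<mu>\<^sub>n = \<pi> P\<^sub>1 \<cdots> P\<^sub>n\<close>. For \<open>\<zeta> > 1\<close> its increments are \<open>O(n\<^sup>-\<^sup>\<zeta>)\<close>, hence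
  summable. For \<open>\<zeta> \<le> 1\<close> all entries of \<open>P\<^sub>n\<close> are eventually at least \<open>e / n\<close>, so \<open>P\<^sub>n\<close> contracts
  zero-sum vectors in the \<open>\<ell>\<^sup>1\<close> norm by the factor \<open>1 - e / n\<close>; as \<open>\<Sum> 1 / n\<close> diverges, \<open>\<mu>\<^sub>n\<close> approaches
  the vector \<open>\<nu>\<^sub>G\<close>, which every \<open>P\<^sub>n\<close> fixes. The same contraction, applied to a kernel vector
  of the singular matrix \<open>G\<close>, gives existence, positivity and uniqueness of \<open>\<nu>\<^sub>G\<close>. The dependence on
  the parameters shows on generators with all rows of \<open>G + I\<close> equal to some \<open>q > 0\<close>: there \<open>\<nu>\<^sub>G = q\<close>,
  and for \<open>\<zeta> = 2\<close> the initial law is not forgotten because \<open>\<Prod> (1 - 1 / n\<^sup>2) > 0\<close>.\<close>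

section \<open>Marginal vectors, the l1 norm and stochastic matrices\<close>

text \<open>Defined for every row vector, so that signed kernel vectors of \<open>G\<close> can be
  propagated and compared with genuine laws.\<close>

primrec marginal :: "real^'m^'m \<Rightarrow> real \<Rightarrow> real^'m \<Rightarrow> nat \<Rightarrow> real^'m" where
  "marginal G \<zeta> \<pi> 0 = \<pi>"
| "marginal G \<zeta> \<pi> (Suc n) = marginal G \<zeta> \<pi> n v* trans_mat G \<zeta> (Suc n)"

text \<open>Total through \<open>lim\<close>; the value is meaningful where convergence is proved,
  in \<open>marginal_tendsto_limit_law\<close>.\<close>

definition limit_law :: "real^'m^'m \<Rightarrow> real^'m \<Rightarrow> real \<Rightarrow> real^'m" where
  "limit_law G \<pi> \<zeta> = lim (marginal G \<zeta> \<pi>)"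

text \<open>The norm that stochastic matrices acting on row vectors do not increase;
  \<open>norm\<close> on \<open>real^'m\<close> is Euclidean.\<close>

definition l1_norm :: "real^'m \<Rightarrow> real" where
  "l1_norm x = (\<Sum>i\<in>UNIV. \<bar>x $ i\<bar>)"

lemma l1_norm_nonneg: "0 \<le> l1_norm x"
  by (simp add: l1_norm_def sum_nonneg)

lemma norm_le_l1_norm: "norm x \<le> l1_norm (x :: real^'m)"
  unfolding l1_norm_def by (rule norm_le_l1_cart)

lemma l1_norm_prob_vector: "p \<in> prob_vectors \<Longrightarrow> l1_norm p = 1"
  by (simp add: l1_norm_def prob_vectors_def)

lemma prob_vectors_nonneg: "p \<in> prob_vectors \<Longrightarrow> 0 \<le> p $ i"
  by (simp add: prob_vectors_def)

lemma sum_prob_vector: "p \<in> prob_vectors \<Longrightarrow> (\<Sum>i\<in>UNIV. p $ i) = 1"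
  by (simp add: prob_vectors_def)

lemma sum_vector_matrix_stochastic:
  fixes P :: "real^'m^'m"
  assumes "\<And>i. P $ i \<in> prob_vectors"
  shows "(\<Sum>j\<in>UNIV. (x v* P) $ j) = (\<Sum>i\<in>UNIV. x $ i)"
proof -
  have "(\<Sum>j\<in>UNIV. (x v* P) $ j) = (\<Sum>i\<in>UNIV. \<Sum>j\<in>UNIV. x $ i * P $ i $ j)"
    unfolding vector_matrix_mult_def by (subst sum.swap) simp
  also have "\<dots> = (\<Sum>i\<in>UNIV. x $ i)"
    using sum_prob_vector[OF assms] by (simp flip: sum_distrib_left)
  finally show ?thesis .
qed

lemma vector_matrix_prob_vector:
  fixes P :: "real^'m^'m"
  assumes P: "\<And>i. P $ i \<in> prob_vectors" and p: "p \<in> prob_vectors"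
  shows "p v* P \<in> prob_vectors"
proof -
  have "0 \<le> (p v* P) $ j" for j
    using prob_vectors_nonneg[OF p] prob_vectors_nonneg[OF P]
    by (simp add: vector_matrix_mult_def sum_nonneg)
  moreover have "(\<Sum>j\<in>UNIV. (p v* P) $ j) = 1"
    by (simp add: sum_vector_matrix_stochastic[OF P] sum_prob_vector[OF p])
  ultimately show ?thesis by (simp add: prob_vectors_def)
qed

lemma marginal_prob_vector:
  assumes "G \<in> generators" "\<zeta> > 0" "\<pi> \<in> prob_vectors"
  shows "marginal G \<zeta> \<pi> n \<in> prob_vectors"
  by (induction n) (auto intro: vector_matrix_prob_vector trans_mat_stochastic assms)

lemma vector_trans_mat:
  "x v* trans_mat G \<zeta> n =
     (if n \<le> threshold G \<zeta> then x else x + (1 / real n powr \<zeta>) *\<^sub>R (x v* G))"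
  by (simp add: trans_mat_def vector_matrix_mult_add_rdistrib vector_scaleR_matrix_ac)

lemma closed_prob_vectors: "closed (prob_vectors :: (real^'m) set)"
proof -
  have "closed {p :: real^'m. (\<forall>i. 0 \<le> p $ i) \<and> (\<Sum>i\<in>UNIV. p $ i) = 1}"
    by (intro closed_Collect_conj closed_Collect_all closed_Collect_le closed_Collect_eq
        continuous_intros)
  then show ?thesis by (simp add: prob_vectors_def)
qed

section \<open>From the path law to convergence of marginals\<close>

text \<open>The chain law conditions on the whole past, so the one-step recursion is obtained by
  summing over all histories up to time \<open>n\<close> and regrouping them by their last
  state.\<close>

lemma measure_chain_law_coordinate:
  fixes G :: "real^'m^'m"
  assumes "is_chain_law G \<zeta> \<pi> M"
  shows "measure M {\<omega>. \<omega> n = j} = marginal G \<zeta> \<pi> n $ j"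
proof (induction n arbitrary: j)
  interpret prob_space M using assms by (simp add: is_chain_law_def)
  have setsM: "sets M = sets path_space" using assms by (simp add: is_chain_law_def)
  have sp: "space M = UNIV"
    using sets_eq_imp_space_eq[OF setsM] by (simp add: space_PiM)
  {
    case 0
    then show ?case using assms by (simp add: is_chain_law_def sp)
  next
    case (Suc n)
    have coord [measurable]: "(\<lambda>\<omega>. \<omega> k) \<in> measurable M (count_space UNIV)" for k
      by (simp add: measurable_cong_sets[OF setsM refl])
    \<comment> \<open>Histories are represented by functions extensional outside
      \<open>{..n}\<close>: there are finitely many, and their cylinders \<open>A x\<close>
      partition path space.\<close>
    define X where "X = (PiE {..n} (\<lambda>_. UNIV) :: (nat \<Rightarrow> 'm) set)"
    define A where "A x = {\<omega>. \<forall>k\<le>n. \<omega> k = x k}" for x :: "nat \<Rightarrow> 'm"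
    have finX: "finite X" by (simp add: X_def finite_PiE)
    have A_meas: "A x \<in> sets M" for x
    proof -
      have "{\<omega> \<in> space M. \<forall>k\<in>{..n}. \<omega> k = x k} \<in> sets M" by measurable
      then show ?thesis by (simp add: A_def sp atMost_def)
    qed
    have coord_meas: "{\<omega>. \<omega> k = i} \<in> sets M" for k i
    proof -
      have "{\<omega> \<in> space M. \<omega> k = i} \<in> sets M" by measurable
      then show ?thesis by (simp add: sp)
    qed
    have total: "measure M B = (\<Sum>x\<in>X. measure M (A x \<inter> B))" if B: "B \<in> sets M" for B
    proof -
      have "disjoint_family_on (\<lambda>x. A x \<inter> B) X"
        unfolding disjoint_family_on_def
      proof (intro ballI impI)
        fix x y assume xy: "x \<in> X" "y \<in> X" "x \<noteq> y"
        then obtain k where "k \<le> n" "x k \<noteq> y k"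
          unfolding X_def by (metis PiE_ext atMost_iff)
        then show "(A x \<inter> B) \<inter> (A y \<inter> B) = {}" by (auto simp: A_def)
      qed
      moreover have "(\<Union>x\<in>X. A x \<inter> B) = B"
      proof -
        have "restrict \<omega> {..n} \<in> X \<and> \<omega> \<in> A (restrict \<omega> {..n})" for \<omega>
          by (simp add: X_def A_def)
        then show ?thesis by blast
      qed
      ultimately show ?thesis
        using finite_measure_finite_Union[of X "\<lambda>x. A x \<inter> B"] finX A_meas B by auto
    qed
    have transition: "measure M (A x \<inter> {\<omega>. \<omega> (Suc n) = j}) =
        measure M (A x) * trans_mat G \<zeta> (Suc n) $ x n $ j" for x
    \<comment> \<open>The chain law prescribes nothing on null cylinders; there both sides
      vanish.\<close>
    proof (cases "measure M (A x) = 0")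
      case True
      then have "measure M (A x \<inter> {\<omega>. \<omega> (Suc n) = j}) = 0"
        using finite_measure_mono[of "A x \<inter> {\<omega>. \<omega> (Suc n) = j}" "A x"] A_meas
        by (simp add: measure_le_0_iff)
      with True show ?thesis by simp
    next
      case False
      then have pos: "0 < measure M (A x)" by (simp add: zero_less_measure_iff)
      then have "\<P>(\<omega> in M. \<omega> (Suc n) = j \<bar> \<forall>k\<le>n. \<omega> k = x k) = trans_mat G \<zeta> (Suc n) $ x n $ j"
        using assms by (simp add: is_chain_law_def A_def sp)
      moreover have "A x \<inter> {\<omega>. \<omega> (Suc n) = j} = {\<omega>. \<omega> (Suc n) = j \<and> (\<forall>k\<le>n. \<omega> k = x k)}"
        by (auto simp: A_def)
      ultimately show ?thesis using pos by (simp add: cond_prob_def sp A_def field_simps)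
    qed
    have current: "measure M (A x \<inter> {\<omega>. \<omega> n = i}) = (if x n = i then measure M (A x) else 0)" for x i
    proof -
      have "A x \<inter> {\<omega>. \<omega> n = i} = (if x n = i then A x else {})" by (auto simp: A_def)
      then show ?thesis by simp
    qed
    have "measure M {\<omega>. \<omega> (Suc n) = j} =
        (\<Sum>x\<in>X. measure M (A x) * trans_mat G \<zeta> (Suc n) $ x n $ j)"
      by (subst total[OF coord_meas]) (simp add: transition)
    \<comment> \<open>Only the term \<open>i = x n\<close> of the inner sum can be nonzero. After
      swapping the sums, the histories with last state \<open>i\<close> recombine by
      \<open>total\<close>.\<close>
    also have "\<dots> = (\<Sum>x\<in>X. \<Sum>i\<in>UNIV. measure M (A x \<inter> {\<omega>. \<omega> n = i}) * trans_mat G \<zeta> (Suc n) $ i $ j)"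
      by (simp add: current if_distrib[of "\<lambda>y. y * c" for c] cong: if_cong)
    also have "\<dots> = (\<Sum>i\<in>UNIV. measure M {\<omega>. \<omega> n = i} * trans_mat G \<zeta> (Suc n) $ i $ j)"
      by (subst sum.swap, subst total[OF coord_meas]) (simp add: sum_distrib_right)
    finally show ?case by (simp add: Suc.IH vector_matrix_mult_def)
  }
qed

text \<open>On a finite state space an expectation is a finite sum against the point masses, so it
  inherits the convergence of the marginals.\<close>

lemma coord_conv_in_distr_if_marginal_tendsto:
  fixes G :: "real^'m^'m"
  assumes M: "is_chain_law G \<zeta> \<pi> M" and p: "p \<in> prob_vectors"
    and lim: "marginal G \<zeta> \<pi> \<longlonglongrightarrow> p"
  shows "coord_conv_in_distr M p"
proof -
  interpret prob_space M using M by (simp add: is_chain_law_def)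
  have setsM: "sets M = sets path_space" using M by (simp add: is_chain_law_def)
  have sp: "space M = UNIV"
    using sets_eq_imp_space_eq[OF setsM] by (simp add: space_PiM)
  have coord [measurable]: "(\<lambda>\<omega>. \<omega> k) \<in> measurable M (count_space UNIV)" for k
    by (simp add: measurable_cong_sets[OF setsM refl])
  have expect: "(\<integral>x. f x \<partial>distr M (count_space UNIV) (\<lambda>\<omega>. \<omega> n)) =
      (\<Sum>i\<in>UNIV. marginal G \<zeta> \<pi> n $ i * f i)" for f :: "'m \<Rightarrow> real" and n
  proof -
    let ?D = "distr M (count_space UNIV) (\<lambda>\<omega>. \<omega> n)"
    have meas: "measure ?D {i} = marginal G \<zeta> \<pi> n $ i" for i
      using measure_chain_law_coordinate[OF M, of n i]
      by (simp add: measure_distr sp vimage_def)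
    interpret D: prob_space ?D by (rule prob_space_distr) measurable
    have "?D = point_measure UNIV (\<lambda>i. ennreal (marginal G \<zeta> \<pi> n $ i))"
    proof (rule measure_eqI_finite[where A = UNIV])
      show "emeasure ?D {i} = emeasure (point_measure UNIV (\<lambda>i. ennreal (marginal G \<zeta> \<pi> n $ i))) {i}" for i
        by (simp add: D.emeasure_eq_measure meas emeasure_point_measure_finite)
    qed (simp_all add: sets_point_measure)
    moreover have "0 \<le> marginal G \<zeta> \<pi> n $ i" for i
      using meas[of i] by (metis measure_nonneg)
    ultimately show ?thesis by (simp add: lebesgue_integral_point_measure_finite)
  qed
  have "(\<lambda>n. \<Sum>i\<in>UNIV. marginal G \<zeta> \<pi> n $ i * f i) \<longlonglongrightarrow> (\<Sum>i\<in>UNIV. p $ i * f i)" for f :: "'m \<Rightarrow> real"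
    by (intro tendsto_intros lim)
  moreover have "(\<integral>x. f x \<partial>law_of_vec p) = (\<Sum>i\<in>UNIV. p $ i * f i)" for f :: "'m \<Rightarrow> real"
    using prob_vectors_nonneg[OF p]
    by (simp add: law_of_vec_def lebesgue_integral_point_measure_finite)
  ultimately show ?thesis
    by (simp add: coord_conv_in_distr_def weak_conv_on_def expect)
qed

section \<open>Summable increments for exponents above 1\<close>

lemma marginal_convergent_if_gt_1:
  fixes G :: "real^'m^'m"
  assumes G: "G \<in> generators" and p: "\<pi> \<in> prob_vectors" and z: "\<zeta> > 1"
  shows "convergent (marginal G \<zeta> \<pi>)"
proof -
  \<comment> \<open>Row multiplication by \<open>G\<close> is column multiplication by
    \<open>transpose G\<close>, hence bounded.\<close>
  obtain B where B: "0 < B" "\<And>x. norm (x v* G) \<le> norm x * B"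
    using bounded_linear.pos_bounded[OF matrix_vector_mul_bounded_linear[of "transpose G"]] by auto
  have "norm (marginal G \<zeta> \<pi> n) \<le> 1" for n
    using norm_le_l1_norm[of "marginal G \<zeta> \<pi> n"] l1_norm_prob_vector marginal_prob_vector[OF G _ p, of \<zeta> n] z
    by fastforce
  then have mB: "norm (marginal G \<zeta> \<pi> n v* G) \<le> B" for n
    by (meson B mult_left_le_one_le norm_ge_zero order_trans less_imp_le)
  \<comment> \<open>The increment vanishes up to the threshold; afterwards it is
    \<open>1 / real (Suc n) powr \<zeta>\<close> times
    \<open>marginal G \<zeta> \<pi> n v* G\<close>.\<close>
  have bound: "norm (marginal G \<zeta> \<pi> (Suc n) - marginal G \<zeta> \<pi> n) \<le> B * real (Suc n) powr (- \<zeta>)" for n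
    using mB[of n] B(1)
    by (auto simp: vector_trans_mat powr_minus field_simps divide_right_mono simp del: of_nat_Suc)
  have "summable (\<lambda>n. real (Suc n) powr (- \<zeta>))"
    using z by (subst summable_Suc_iff) (simp add: summable_real_powr_iff)
  then have "summable (\<lambda>n. marginal G \<zeta> \<pi> (Suc n) - marginal G \<zeta> \<pi> n)"
    by (intro summable_comparison_test'[OF summable_mult bound])
  \<comment> \<open>The partial sums of the increments telescope to the marginal minus its initial
    value.\<close>
  then show ?thesis
    by (simp add: summable_iff_convergent sum_lessThan_telescope convergent_diff_const_right_iff del: marginal.simps)
qed

section \<open>Contraction and loss of memory for exponents at most 1\<close>

text \<open>Doeblin minorization: a zero-sum vector does not see the constant \<open>e\<close> subtracted from the entries.\<close>

lemma l1_norm_contraction: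
  fixes P :: "real^'m^'m"
  assumes P: "\<And>i. P $ i \<in> prob_vectors" and e: "0 \<le> e" "\<And>i j. e \<le> P $ i $ j"
    and x: "(\<Sum>i\<in>UNIV. x $ i) = 0"
  shows "l1_norm (x v* P) \<le> (1 - e) * l1_norm x"
proof -
  have "\<bar>(x v* P) $ j\<bar> \<le> (\<Sum>i\<in>UNIV. \<bar>x $ i\<bar> * (P $ i $ j - e))" for j
  proof -
    have "(x v* P) $ j = (\<Sum>i\<in>UNIV. x $ i * (P $ i $ j - e))"
      using x by (simp add: vector_matrix_mult_def right_diff_distrib sum_subtractf flip: sum_distrib_right)
    also have "\<bar>\<dots>\<bar> \<le> (\<Sum>i\<in>UNIV. \<bar>x $ i * (P $ i $ j - e)\<bar>)" by (rule sum_abs)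
    finally show ?thesis using e by (simp add: abs_mult)
  qed
  then have "l1_norm (x v* P) \<le> (\<Sum>j\<in>UNIV. \<Sum>i\<in>UNIV. \<bar>x $ i\<bar> * (P $ i $ j - e))"
    unfolding l1_norm_def by (rule sum_mono)
  also have "\<dots> = (\<Sum>i\<in>UNIV. \<bar>x $ i\<bar> * (\<Sum>j\<in>UNIV. P $ i $ j - e))"
    by (subst sum.swap) (simp add: sum_distrib_left)
  also have "\<dots> = (\<Sum>i\<in>UNIV. \<bar>x $ i\<bar> * (1 - real CARD('m) * e))"
    by (simp add: sum_subtractf sum_prob_vector[OF P])
  also have "\<dots> = (1 - real CARD('m) * e) * l1_norm x"
    by (simp add: l1_norm_def sum_distrib_left mult.commute)
  \<comment> \<open>The dimension is dropped from the factor, using that there is at least one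
    state.\<close>
  also have "\<dots> \<le> (1 - e) * l1_norm x"
  proof -
    have "1 * e \<le> real CARD('m) * e" using e by (intro mult_right_mono) auto
    then show ?thesis by (intro mult_right_mono l1_norm_nonneg) simp
  qed
  finally show ?thesis .
qed

text \<open>Past the threshold the off-diagonal entries are those of \<open>G\<close> divided by
  \<open>real n powr \<zeta>\<close>, while the diagonal ones tend to 1 and eventually exceed any
  multiple of \<open>1 / real n powr \<zeta>\<close>.\<close>

lemma trans_mat_minorization:
  fixes G :: "real^'m^'m"
  assumes G: "G \<in> generators" and z: "\<zeta> > 0"
  obtains e N where "0 < e"
    "\<And>n i j. N < n \<Longrightarrow> e / real n powr \<zeta> \<le> trans_mat G \<zeta> n $ i $ j"
proof -
  \<comment> \<open>Inserting 1 keeps the set nonempty when there is only one state.\<close>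
  define e where "e = Min (insert 1 {G $ i $ j | i j. i \<noteq> j})"
  have fin: "finite {G $ i $ j | i j. i \<noteq> j}"
    by (rule finite_subset[of _ "(\<lambda>(i, j). G $ i $ j) ` UNIV"]) auto
  have "0 < e" using G fin by (auto simp: e_def generators_def)
  have e_le: "e \<le> G $ i $ j" if "i \<noteq> j" for i j
    unfolding e_def using fin that by (intro Min_le) auto
  have "\<forall>\<^sub>F n in sequentially. c \<le> real n powr \<zeta>" for c
    using z by real_asymp
  \<comment> \<open>The l1 norm of the diagonal bounds all \<open>\<bar>G $ i $ i\<bar>\<close> at
    once, so beyond \<open>N\<close> the numerator \<open>real n powr \<zeta> + G $ i $ i\<close> of
    every diagonal entry is at least \<open>e\<close>.\<close>
  from this[of "e + l1_norm (\<chi> i. G $ i $ i)"] obtain N where N: "\<And>n. n \<ge> N \<Longrightarrow> e + l1_norm (\<chi> i. G $ i $ i) \<le> real n powr \<zeta>"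
    by (auto simp: eventually_sequentially)
  have "e / real n powr \<zeta> \<le> trans_mat G \<zeta> n $ i $ j" if n: "max N (threshold G \<zeta>) < n" for n i j
  proof -
    have pos: "0 < real n powr \<zeta>" using n by simp
    have "\<bar>G $ i $ i\<bar> \<le> l1_norm (\<chi> i. G $ i $ i)"
      using member_le_sum[of i UNIV "\<lambda>i. \<bar>G $ i $ i\<bar>"] by (simp add: l1_norm_def)
    then have diag: "e \<le> real n powr \<zeta> + G $ i $ i" using N[of n] n by simp
    show ?thesis
      using n pos diag e_le[of i j] by (auto simp add: trans_mat_def mat_def field_simps)
  qed
  then show ?thesis using that[of e "max N (threshold G \<zeta>)"] \<open>0 < e\<close> by auto
qed

text \<open>By \<open>1 - t \<le> exp (- t)\<close>, the sequence
  \<open>a n * exp (e * harm n)\<close> does not increase from \<open>N\<close> on, and the harmonic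
  numbers diverge.\<close>

lemma tendsto_0_if_harmonic_contraction:
  fixes a :: "nat \<Rightarrow> real"
  assumes a: "\<And>n. 0 \<le> a n" and e: "0 < e"
    and step: "\<And>n. N \<le> n \<Longrightarrow> a (Suc n) \<le> (1 - e / real (Suc n)) * a n"
  shows "a \<longlonglongrightarrow> 0"
proof -
  have bound: "a n * exp (e * harm n) \<le> a N * exp (e * harm N)" if "N \<le> n" for n
    using that
  proof (induction n rule: dec_induct)
    case (step n)
    have "a (Suc n) \<le> (1 - e / real (Suc n)) * a n" using assms(3) step by simp
    also have "\<dots> \<le> exp (- (e / real (Suc n))) * a n"
      using exp_ge_add_one_self[of "- (e / real (Suc n))"] a by (intro mult_right_mono) auto
    finally have "a (Suc n) * exp (e * harm (Suc n)) \<le>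
        exp (- (e / real (Suc n))) * a n * exp (e * harm (Suc n))"
      by (rule mult_right_mono) simp
    also have "\<dots> = a n * exp (e * harm n)"
      by (simp add: harm_Suc distrib_left exp_add exp_minus divide_inverse del: of_nat_Suc)
    finally show ?case using step by simp
  qed simp
  have "filterlim (\<lambda>n. - (e * harm n :: real)) at_bot sequentially"
    using e by (simp add: filterlim_uminus_at_bot filterlim_tendsto_pos_mult_at_top[OF tendsto_const] harm_at_top)
  then have "(\<lambda>n. exp (- (e * harm n :: real))) \<longlonglongrightarrow> 0"
    by (rule filterlim_compose[OF exp_at_bot])
  then have lim: "(\<lambda>n. a N * exp (e * harm N) * exp (- (e * harm n))) \<longlonglongrightarrow> 0"
    by (rule tendsto_mult_right_zero)
  have "a n \<le> a N * exp (e * harm N) * exp (- (e * harm n))" if "N \<le> n" for n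
    using bound[OF that] by (simp add: exp_minus field_simps)
  then show ?thesis
    using a by (intro tendsto_sandwich[OF _ _ tendsto_const lim]) (auto simp: eventually_sequentially)
qed

text \<open>Stated for vectors of equal sum, of either sign, so that it compares a law with a kernel
  vector of \<open>G\<close> and two kernel vectors with each other.\<close>

lemma marginal_diff_tendsto_0:
  fixes G :: "real^'m^'m"
  assumes G: "G \<in> generators" and z: "0 < \<zeta>" "\<zeta> \<le> 1"
    and pq: "(\<Sum>i\<in>UNIV. p $ i) = (\<Sum>i\<in>UNIV. q $ i)"
  shows "(\<lambda>n. marginal G \<zeta> p n - marginal G \<zeta> q n) \<longlonglongrightarrow> 0"
proof -
  obtain e N where e: "0 < e" and minor: "\<And>n i j. N < n \<Longrightarrow> e / real n powr \<zeta> \<le> trans_mat G \<zeta> n $ i $ j"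
    using trans_mat_minorization[OF G z(1)] by metis
  define d where "d n = marginal G \<zeta> p n - marginal G \<zeta> q n" for n
  have d_Suc: "d (Suc n) = d n v* trans_mat G \<zeta> (Suc n)" for n
    by (simp add: d_def vector_matrix_mult_diff_distrib)
  have d_sum: "(\<Sum>i\<in>UNIV. d n $ i) = 0" for n
  proof (induction n)
    case 0
    then show ?case using pq by (simp add: d_def sum_subtractf)
  next
    case (Suc n)
    then show ?case
      by (simp add: d_Suc sum_vector_matrix_stochastic trans_mat_stochastic[OF G z(1)])
  qed
  have "l1_norm (d (Suc n)) \<le> (1 - e / real (Suc n)) * l1_norm (d n)" if "N \<le> n" for n
  proof -
    \<comment> \<open>Here \<open>\<zeta> \<le> 1\<close> enters: it turns the minorization into one
      by a harmonic term.\<close>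
    have "real (Suc n) powr \<zeta> \<le> real (Suc n) powr 1" using z by (intro powr_mono) auto
    then have "e / real (Suc n) \<le> e / real (Suc n) powr \<zeta>"
      using e by (intro divide_left_mono) auto
    then have "e / real (Suc n) \<le> trans_mat G \<zeta> (Suc n) $ i $ j" for i j
      using minor[of "Suc n" i j] that by linarith
    then show ?thesis
      unfolding d_Suc using e by (intro l1_norm_contraction trans_mat_stochastic G z(1) d_sum) auto
  qed
  then have "(\<lambda>n. l1_norm (d n)) \<longlonglongrightarrow> 0"
    using tendsto_0_if_harmonic_contraction[of "\<lambda>n. l1_norm (d n)", OF l1_norm_nonneg e] by blast
  then have "d \<longlonglongrightarrow> 0"
    by (rule Lim_null_comparison[rotated]) (simp add: norm_le_l1_norm)
  then show ?thesis by (simp add: d_def[abs_def])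
qed

section \<open>The stationary distribution\<close>

lemma marginal_eq_self_if_kernel: "v v* G = 0 \<Longrightarrow> marginal G \<zeta> v n = v"
  by (induction n) (simp_all add: vector_trans_mat)

text \<open>With exponent 1 both vectors stay constant under the recursion, yet their difference
  must tend to 0.\<close>

lemma kernel_eq_if_sum_eq:
  fixes G :: "real^'m^'m"
  assumes "G \<in> generators" and "v v* G = 0" "w v* G = 0"
    and "(\<Sum>i\<in>UNIV. v $ i) = (\<Sum>i\<in>UNIV. w $ i)"
  shows "v = w"
  using marginal_diff_tendsto_0[OF assms(1), of 1 v w] assms
  by (simp add: marginal_eq_self_if_kernel LIMSEQ_const_iff)

text \<open>The rows of \<open>G\<close> sum to 0, so the all-ones vector lies in the right kernel;
  a singular square matrix has a nontrivial left kernel too.\<close>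

lemma left_kernel_nontrivial:
  fixes G :: "real^'m^'m"
  assumes G: "G \<in> generators"
  obtains v where "v \<noteq> 0" "v v* G = 0"
proof -
  have "(\<Sum>j\<in>UNIV. G $ i $ j) = 0" for i
    using G sum.remove[of UNIV i "\<lambda>j. G $ i $ j"] by (simp add: generators_def)
  then have "G *v 1 = 0" by (simp add: matrix_vector_mult_def vec_eq_iff)
  then have "\<nexists>B. B ** G = mat 1"
    unfolding matrix_left_invertible_ker by (metis zero_neq_one)
  moreover have "B ** G = mat 1" if "transpose B ** transpose G = mat 1" for B
    using that by (metis matrix_left_right_inverse matrix_transpose_mul transpose_mat transpose_transpose)
  ultimately have "\<nexists>B. B ** transpose G = mat 1"
    by (metis transpose_transpose)
  then show ?thesis
    using that unfolding matrix_left_invertible_ker by auto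
qed

lemma ex_positive_stationary:
  fixes G :: "real^'m^'m"
  assumes G: "G \<in> generators"
  obtains v where "v v* G = 0" "\<And>i. 0 < v $ i" "(\<Sum>i\<in>UNIV. v $ i) = 1"
proof -
  obtain u where u: "u \<noteq> 0" "u v* G = 0" using left_kernel_nontrivial[OF G] .
  define s where "s = (\<Sum>i\<in>UNIV. u $ i)"
  \<comment> \<open>A kernel vector of sum 0 would coincide with the kernel vector 0.\<close>
  have "s \<noteq> 0"
    using kernel_eq_if_sum_eq[OF G u(2), of 0] u(1) by (auto simp: s_def)
  define v where "v = (1 / s) *\<^sub>R u"
  have v0: "v v* G = 0" using u by (simp add: v_def scaleR_vector_matrix_assoc)
  have v1: "(\<Sum>i\<in>UNIV. v $ i) = 1"
    using \<open>s \<noteq> 0\<close> unfolding v_def s_def by (simp flip: sum_divide_distrib)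
  \<comment> \<open>The chain with exponent 1 started at any state \<open>k\<close> converges to
    \<open>v\<close>, so \<open>v\<close> is a limit of probability vectors and has no negative
    entries.\<close>
  obtain k :: 'm where True by blast
  have ax: "axis k 1 \<in> prob_vectors" by (simp add: prob_vectors_def axis_def)
  have "(\<lambda>n. marginal G 1 (axis k 1) n - v) \<longlonglongrightarrow> 0"
    using marginal_diff_tendsto_0[OF G, of 1 "axis k 1" v] v0 v1 sum_prob_vector[OF ax]
    by (simp add: marginal_eq_self_if_kernel)
  then have "marginal G 1 (axis k 1) \<longlonglongrightarrow> v" by (rule LIM_zero_cancel)
  then have v: "v \<in> prob_vectors"
    by (rule closed_sequentially[OF closed_prob_vectors marginal_prob_vector[OF G zero_less_one ax]])
  obtain e N where e: "0 < e" and minor: "\<And>n i j. N < n \<Longrightarrow> e / real n powr 1 \<le> trans_mat G 1 n $ i $ j"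
    using trans_mat_minorization[OF G zero_less_one] by metis
  \<comment> \<open>At this time every entry of the transition matrix is at least
    \<open>e / real n > 0\<close>; as \<open>v\<close> is fixed by that matrix and has total mass 1,
    its entries inherit the bound.\<close>
  define n where "n = Suc N"
  have "0 < v $ j" for j
  proof -
    have "e / real n = (\<Sum>i\<in>UNIV. v $ i * (e / real n))"
      unfolding sum_distrib_right[symmetric] v1 by simp
    also have "\<dots> \<le> (\<Sum>i\<in>UNIV. v $ i * trans_mat G 1 n $ i $ j)"
      using minor[of n] prob_vectors_nonneg[OF v] by (intro sum_mono mult_left_mono) (auto simp: n_def)
    also have "\<dots> = (v v* trans_mat G 1 n) $ j" by (simp add: vector_matrix_mult_def)
    also have "\<dots> = v $ j" by (simp add: vector_trans_mat v0)
    finally have "e / real n \<le> v $ j" .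
    moreover have "0 < e / real n" using e by (simp add: n_def)
    ultimately show ?thesis by linarith
  qed
  then show ?thesis using that v0 v1 by blast
qed

lemma stationary_eqI:
  fixes G :: "real^'m^'m"
  assumes "G \<in> generators" and "v v* G = 0" "\<And>i. 0 < v $ i" "(\<Sum>i\<in>UNIV. v $ i) = 1"
  shows "stationary G = v"
  unfolding stationary_def
proof (rule the_equality)
  show "w = v" if "w v* G = 0 \<and> (\<forall>i. 0 < w $ i) \<and> (\<Sum>i\<in>UNIV. w $ i) = 1" for w
    using kernel_eq_if_sum_eq[OF assms(1), of w v] assms(2,4) that by simp
qed (use assms in simp)

section \<open>Limits of the marginals\<close>

lemma marginal_tendsto_stationary:
  fixes G :: "real^'m^'m"
  assumes G: "G \<in> generators" and z: "0 < \<zeta>" "\<zeta> \<le> 1" and p: "\<pi> \<in> prob_vectors"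
  shows "marginal G \<zeta> \<pi> \<longlonglongrightarrow> stationary G"
proof -
  obtain v where v: "v v* G = 0" "\<And>i. 0 < v $ i" "(\<Sum>i\<in>UNIV. v $ i) = 1"
    using ex_positive_stationary[OF G] by blast
  have "(\<lambda>n. marginal G \<zeta> \<pi> n - v) \<longlonglongrightarrow> 0"
    using marginal_diff_tendsto_0[OF G z, of \<pi> v] v sum_prob_vector[OF p]
    by (simp add: marginal_eq_self_if_kernel)
  then show ?thesis
    using stationary_eqI[OF G v] by (simp add: LIM_zero_cancel)
qed

lemma marginal_tendsto_limit_law:
  fixes G :: "real^'m^'m"
  assumes "G \<in> generators" "\<zeta> > 0" "\<pi> \<in> prob_vectors"
  shows "marginal G \<zeta> \<pi> \<longlonglongrightarrow> limit_law G \<pi> \<zeta>"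
proof -
  have "convergent (marginal G \<zeta> \<pi>)"
    using assms marginal_convergent_if_gt_1 marginal_tendsto_stationary convergentI
    by (metis not_le)
  then show ?thesis by (simp add: limit_law_def convergent_LIMSEQ_iff)
qed

lemma limit_law_prob_vector:
  fixes G :: "real^'m^'m"
  assumes "G \<in> generators" "\<zeta> > 0" "\<pi> \<in> prob_vectors"
  shows "limit_law G \<pi> \<zeta> \<in> prob_vectors"
  by (rule closed_sequentially[OF closed_prob_vectors marginal_prob_vector[OF assms]
        marginal_tendsto_limit_law[OF assms]])

lemma limit_law_eq_stationary:
  fixes G :: "real^'m^'m"
  assumes "G \<in> generators" "\<zeta> > 0" "\<zeta> \<le> 1" "\<pi> \<in> prob_vectors"
  shows "limit_law G \<pi> \<zeta> = stationary G"
  using LIMSEQ_unique[OF marginal_tendsto_limit_law[OF assms(1,2,4)] marginal_tendsto_stationary[OF assms]] .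

section \<open>Explicit generators showing the dependence on the parameters\<close>

text \<open>Generator of the process that at rate 1 resamples its state from \<open>q\<close>. It
  acts as -1 on zero-sum row vectors, so differences of marginals are merely rescaled.\<close>

definition rank_one_generator :: "real^'m \<Rightarrow> real^'m^'m" where
  "rank_one_generator q = (\<chi> i. q) - mat 1"

lemma rank_one_generator_in_generators:
  fixes q :: "real^'m"
  assumes "\<And>i. 0 < q $ i" "(\<Sum>i\<in>UNIV. q $ i) = 1"
  shows "rank_one_generator q \<in> generators"
proof -
  have "q $ i - 1 = - (\<Sum>j\<in>UNIV - {i}. q $ j)" for i
    using assms(2) sum.remove[of UNIV i "\<lambda>j. q $ j"] by simp
  moreover have "(\<Sum>j\<in>UNIV - {i}. rank_one_generator q $ i $ j) = (\<Sum>j\<in>UNIV - {i}. q $ j)" for i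
    by (rule sum.cong) (auto simp: rank_one_generator_def mat_def)
  ultimately show ?thesis
    using assms(1) by (auto simp: generators_def) (simp_all add: rank_one_generator_def mat_def)
qed

lemma vector_rank_one_generator:
  "x v* rank_one_generator q = (\<Sum>i\<in>UNIV. x $ i) *\<^sub>R q - x"
proof -
  have "x v* (\<chi> i. q) = (\<Sum>i\<in>UNIV. x $ i) *\<^sub>R q"
    by (simp add: vector_matrix_mult_def vec_eq_iff sum_distrib_right)
  then show ?thesis by (simp add: rank_one_generator_def vector_matrix_mult_diff_rdistrib)
qed

lemma stationary_rank_one_generator:
  fixes q :: "real^'m"
  assumes "\<And>i. 0 < q $ i" "(\<Sum>i\<in>UNIV. q $ i) = 1"
  shows "stationary (rank_one_generator q) = q"
  using assms
  by (intro stationary_eqI rank_one_generator_in_generators) (simp_all add: vector_rank_one_generator)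

text \<open>Guarantees that the first transition matrix is the identity. In the rank-one example
  with exponent 2, the factor \<open>1 - 1 / n\<^sup>2\<close> would be 0 at \<open>n = 1\<close>
  and erase the initial law.\<close>

lemma threshold_pos:
  fixes G :: "real^'m^'m"
  assumes "G $ i $ i \<noteq> 0"
  shows "0 < threshold G \<zeta>"
proof -
  have "0 < \<bar>G $ i $ i\<bar> powr (1 / \<zeta>)" using assms by simp
  also have "\<dots> \<le> (MAX i. \<bar>G $ i $ i\<bar> powr (1 / \<zeta>))" by (rule Max_ge) auto
  finally show ?thesis by (simp add: threshold_def)
qed

text \<open>Each step \<open>n \<ge> 2\<close> multiplies the difference of the two marginals by \<open>1\<close> or \<open>1 - 1 / n\<^sup>2\<close>,
  and \<open>(n + 1) / (2 n)\<close> is the product of the factors \<open>1 - 1 / k\<^sup>2\<close> over \<open>2 \<le> k \<le> n\<close>.\<close>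

lemma limit_law_rank_one_generator_depends_on_initial:
  fixes q :: "real^'m"
  assumes q: "\<And>i. 0 < q $ i" "(\<Sum>i\<in>UNIV. q $ i) = 1" and ab: "a \<noteq> b"
  shows "limit_law (rank_one_generator q) (axis a 1) 2 \<noteq> limit_law (rank_one_generator q) (axis b 1) 2"
proof -
  let ?G = "rank_one_generator q"
  have G: "?G \<in> generators" using q by (rule rank_one_generator_in_generators)
  have ax: "axis k 1 \<in> prob_vectors" for k :: 'm by (simp add: prob_vectors_def axis_def)
  \<comment> \<open>This makes the diagonal entry \<open>q $ a - 1\<close> of the generator nonzero,
    hence the threshold positive.\<close>
  have "q $ a < 1"
  proof -
    have "q $ a + q $ b = sum (($) q) {a, b}" using ab by simp
    also have "\<dots> \<le> sum (($) q) UNIV" using q by (intro sum_mono2) (auto simp: less_imp_le)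
    finally show ?thesis using q by (smt (verit))
  qed
  then have thr: "0 < threshold ?G 2"
    by (intro threshold_pos[of _ a]) (simp add: rank_one_generator_def mat_def)
  define d where "d n = marginal ?G 2 (axis a 1) n - marginal ?G 2 (axis b 1) n" for n
  have d_sum: "(\<Sum>i\<in>UNIV. d n $ i) = 0" for n
    using sum_prob_vector[OF marginal_prob_vector[OF G _ ax], of 2] by (simp add: d_def sum_subtractf)
  have d_Suc: "d (Suc n) = (if Suc n \<le> threshold ?G 2 then d n else (1 - 1 / (real (Suc n))\<^sup>2) *\<^sub>R d n)" for n
  proof -
    have "d (Suc n) = d n v* trans_mat ?G 2 (Suc n)"
      by (simp add: d_def vector_matrix_mult_diff_distrib)
    then show ?thesis
      by (simp add: vector_trans_mat vector_rank_one_generator d_sum algebra_simps del: of_nat_Suc)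
  qed
  have lower: "(real n + 1) / (2 * real n) \<le> d n $ a" if "1 \<le> n" for n
    using that
  proof (induction n rule: dec_induct)
    \<comment> \<open>The first step is the identity, so the entry at \<open>a\<close> is still 1,
      which is the bound at \<open>n = 1\<close>.\<close>
    case base
    then show ?case using thr ab d_Suc[of 0] by (simp add: d_def axis_def)
  next
    case (step n)
    have n: "0 < real n" using step by simp
    have "(real (Suc n) + 1) / (2 * real (Suc n)) =
        (1 - 1 / (real (Suc n))\<^sup>2) * ((real n + 1) / (2 * real n))"
      using n by (simp add: divide_simps) (simp add: algebra_simps power2_eq_square)
    also have "\<dots> \<le> (1 - 1 / (real (Suc n))\<^sup>2) * d n $ a"
      using step by (intro mult_left_mono) auto
    \<comment> \<open>Up to the threshold the true factor is 1 instead; this only enlarges the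
      result, as the entry is nonnegative.\<close>
    also have "\<dots> \<le> d (Suc n) $ a"
    proof -
      have "0 \<le> (real n + 1) / (2 * real n)" by simp
      with step have "0 \<le> d n $ a" by linarith
      then show ?thesis by (simp add: d_Suc left_diff_distrib)
    qed
    finally show ?case .
  qed
  have "1 / 2 \<le> d n $ a" if "1 \<le> n" for n
  proof -
    have "1 / 2 \<le> (real n + 1) / (2 * real n)" using that by (simp add: field_simps)
    then show ?thesis using lower[OF that] by linarith
  qed
  moreover have "(\<lambda>n. d n $ a) \<longlonglongrightarrow> (limit_law ?G (axis a 1) 2 - limit_law ?G (axis b 1) 2) $ a"
    unfolding d_def using marginal_tendsto_limit_law[OF G _ ax, of 2] by (intro tendsto_intros) auto
  ultimately have "1 / 2 \<le> (limit_law ?G (axis a 1) 2 - limit_law ?G (axis b 1) 2) $ a"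
    by (intro LIMSEQ_le_const) auto
  then show ?thesis by auto
qed

text \<open>The last three conjuncts make "depending in general" precise: each varies one parameter
  with the other two fixed. Two distinct states supply the two starting points and the two laws
  \<open>q\<close>.\<close>

theorem theorem1p1:
  assumes "CARD('m::finite) \<ge> 2"
  shows "\<exists>\<nu> :: real^'m^'m \<Rightarrow> real^'m \<Rightarrow> real \<Rightarrow> real^'m.
    (\<forall>G\<in>generators. \<forall>\<pi>\<in>prob_vectors. \<forall>\<zeta>>0.
       \<nu> G \<pi> \<zeta> \<in> prob_vectors \<and>
       (\<forall>M. is_chain_law G \<zeta> \<pi> M \<longrightarrow> coord_conv_in_distr M (\<nu> G \<pi> \<zeta>)) \<and>
       (\<zeta> \<le> 1 \<longrightarrow> \<nu> G \<pi> \<zeta> = stationary G)) \<and>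
    (\<exists>G\<in>generators. \<exists>\<pi>\<in>prob_vectors. \<exists>\<zeta>>0. \<exists>\<zeta>'>0. \<nu> G \<pi> \<zeta> \<noteq> \<nu> G \<pi> \<zeta>') \<and>
    (\<exists>G\<in>generators. \<exists>G'\<in>generators. \<exists>\<pi>\<in>prob_vectors. \<exists>\<zeta>>0. \<nu> G \<pi> \<zeta> \<noteq> \<nu> G' \<pi> \<zeta>) \<and>
    (\<exists>G\<in>generators. \<exists>\<pi>\<in>prob_vectors. \<exists>\<pi>'\<in>prob_vectors. \<exists>\<zeta>>0. \<nu> G \<pi> \<zeta> \<noteq> \<nu> G \<pi>' \<zeta>)"
proof -
  obtain a b :: 'm where ab: "a \<noteq> b"
    using assms by (metis card_2_iff' ex_card)
  \<comment> \<open>The weight is uniform except that \<open>k\<close> counts twice, which gives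
    distinct positive laws for distinct \<open>k\<close>.\<close>
  define q :: "'m \<Rightarrow> real^'m" where "q k = (\<chi> i. (if i = k then 2 else 1) / (real CARD('m) + 1))" for k
  have q_pos: "0 < q k $ i" for k i by (simp add: q_def)
  have q_sum: "(\<Sum>i\<in>UNIV. q k $ i) = 1" for k
  proof -
    have "(\<Sum>i\<in>UNIV. if i = k then 2 else 1 :: real) = (\<Sum>i\<in>UNIV. 1 + (if i = k then 1 else 0))"
      by (rule sum.cong) auto
    also have "\<dots> = real CARD('m) + 1" by (simp add: sum.distrib)
    finally show ?thesis by (simp add: q_def flip: sum_divide_distrib)
  qed
  have q_neq: "q a \<noteq> q b"
    using ab by (auto simp: q_def vec_eq_iff field_simps)
  have G: "rank_one_generator (q k) \<in> generators" for k
    using q_pos q_sum by (rule rank_one_generator_in_generators)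
  have ax: "axis k 1 \<in> prob_vectors" for k :: 'm by (simp add: prob_vectors_def axis_def)
  have initial: "limit_law (rank_one_generator (q a)) (axis a 1) 2 \<noteq>
      limit_law (rank_one_generator (q a)) (axis b 1) 2"
    by (rule limit_law_rank_one_generator_depends_on_initial[OF q_pos q_sum ab])
  have eq: "limit_law (rank_one_generator (q k)) (axis l 1) 1 = q k" for k l
    by (simp add: limit_law_eq_stationary G ax stationary_rank_one_generator q_pos q_sum)
  \<comment> \<open>With exponent 1 both starts lead to \<open>q a\<close>, while with exponent 2
    their limits differ; so for at least one start the two exponents disagree.\<close>
  have exponent: "\<exists>k. limit_law (rank_one_generator (q a)) (axis k 1) 2 \<noteq>
      limit_law (rank_one_generator (q a)) (axis k 1) 1"
    using initial eq by metis
  show ?thesis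
  proof (intro exI[of _ limit_law] conjI ballI allI impI)
    fix G :: "real^'m^'m" and \<pi> :: "real^'m" and \<zeta> :: real
    assume *: "G \<in> generators" "\<pi> \<in> prob_vectors" "\<zeta> > 0"
    show "limit_law G \<pi> \<zeta> \<in> prob_vectors" using * by (simp add: limit_law_prob_vector)
    show "coord_conv_in_distr M (limit_law G \<pi> \<zeta>)" if "is_chain_law G \<zeta> \<pi> M" for M
      using that * coord_conv_in_distr_if_marginal_tendsto limit_law_prob_vector marginal_tendsto_limit_law
      by blast
    show "limit_law G \<pi> \<zeta> = stationary G" if "\<zeta> \<le> 1"
      using that * by (simp add: limit_law_eq_stationary)
  next
    show "\<exists>G\<in>generators. \<exists>\<pi>\<in>prob_vectors. \<exists>\<zeta>>0. \<exists>\<zeta>'>0.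
        limit_law G \<pi> \<zeta> \<noteq> limit_law (G :: real^'m^'m) \<pi> \<zeta>'"
    proof -
      obtain k where "limit_law (rank_one_generator (q a)) (axis k 1) 2 \<noteq>
          limit_law (rank_one_generator (q a)) (axis k 1) 1"
        using exponent by blast
      then show ?thesis
        by - (rule bexI[OF _ G[of a]], rule bexI[OF _ ax[of k]], rule exI[of _ 2],
          auto intro: exI[of _ 1])
    qed
  next
    show "\<exists>G\<in>generators. \<exists>G'\<in>generators. \<exists>\<pi>\<in>prob_vectors. \<exists>\<zeta>>0.
        limit_law G \<pi> \<zeta> \<noteq> limit_law (G' :: real^'m^'m) \<pi> \<zeta>"
      by (rule bexI[OF _ G[of a]], rule bexI[OF _ G[of b]], rule bexI[OF _ ax[of a]], rule exI[of _ 1])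
        (simp add: eq q_neq)
  next
    show "\<exists>G\<in>generators. \<exists>\<pi>\<in>prob_vectors. \<exists>\<pi>'\<in>prob_vectors. \<exists>\<zeta>>0.
        limit_law G \<pi> \<zeta> \<noteq> limit_law (G :: real^'m^'m) \<pi>' \<zeta>"
      by (rule bexI[OF _ G[of a]], rule bexI[OF _ ax[of a]], rule bexI[OF _ ax[of b]], rule exI[of _ 2])
        (simp add: initial)
  qed
qed

end
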